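(* Let $n\geqslant 3$. Let $\mathcal{ODI}_n$ be the monoid of all order-preserving partial isometries of the cycle graph $C_n$ and let $\mathcal{OPDI}_n$ be the monoid of all orientation-preserving partial isometries of $C_n$. Then $$|\mathcal{ODI}_n|= 3\cdot2^n+\frac{(n+1)n(n-1)}{6}-\frac{1+(-1)^n}{8}n^2-2n-2$$ and $$|\mathcal{OPDI}_n|= n2^n + \frac{n^2(n-1)}{2} -\frac{1+(-1)^n}{4}n^2-n+1.$$
   Context: Let $\Omega_n=\{1<2<\cdots<n\}$. A partial transformation of $\Omega_n$ is a map $\alpha$ from a subset $\mathrm{Dom}(\alpha)\subseteq\Omega_n$ (possibly empty) to $\Omega_n$. The cycle graph $C_n$ has vertex set $\Omega_n$ and edges $\{i,i+1\}$ ($1\leqslant i\leqslant n-1$) and $\{1,n\}$; its geodesic distance is $\mathrm{d}(x,y)=\min\{|x-y|,n-|x-y|\}$. A partial isometry of $C_n$ is a partial transformation $\alpha$ of $\Omega_n$ with $\mathrm{d}(x\alpha,y\alpha)=\mathrm{d}(x,y)$ for all $x,y\in\mathrm{Dom}(\alpha)$ (such $\alpha$ is necessarily injective). The set $\mathcal{DI}_n$ of all partial isometries of $C_n$ is a monoid under composition of partial maps (written left to right), called the dihedral inverse monoid. A partial transformation $\alpha$ is order-preserving if $x\leqslant y$ implies $x\alpha\leqslant y\alpha$ for all $x,y\in\mathrm{Dom}(\alpha)$. A sequence $(a_1,\ldots,a_t)$ ($t\geqslant 0$) of elements of $\Omega_n$ is cyclic if there is at most one index $i\in\{1,\ldots,t\}$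 with $a_i>a_{i+1}$, where $a_{t+1}=a_1$. A partial transformation $\alpha$ with $\mathrm{Dom}(\alpha)=\{a_1<\cdots<a_t\}$ is orientation-preserving if $(a_1\alpha,\ldots,a_t\alpha)$ is cyclic. $\mathcal{ODI}_n$ is the set of order-preserving elements of $\mathcal{DI}_n$, and $\mathcal{OPDI}_n$ is the set of orientation-preserving elements of $\mathcal{DI}_n$. *)

theory Defs
  imports Complex_Main
begin

definition Omega :: "nat \<Rightarrow> nat set" where
  "Omega n = {1..n}"

text \<open>The adjacency relation of the cycle graph (each edge in both directions) and the
  geodesic distance. A pair is in the \<open>k\<close>-th relational power iff there is a walk of
  length \<open>k\<close> between the two vertices.\<close>

definition cycle_adj :: "nat \<Rightarrow> (nat \<times> nat) set" where
  "cycle_adj n = {(i, j). i \<in> Omega n \<and> j \<in> Omega n \<and>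
     (j = i + 1 \<or> i = j + 1 \<or> (i = 1 \<and> j = n) \<or> (i = n \<and> j = 1))}"

definition cycle_dist :: "nat \<Rightarrow> nat \<Rightarrow> nat \<Rightarrow> nat" where
  "cycle_dist n x y = (LEAST k. (x, y) \<in> cycle_adj n ^^ k)"

definition partial_transformations :: "nat \<Rightarrow> (nat \<rightharpoonup> nat) set" where
  "partial_transformations n = {\<alpha>. dom \<alpha> \<subseteq> Omega n \<and> ran \<alpha> \<subseteq> Omega n}"

definition DI :: "nat \<Rightarrow> (nat \<rightharpoonup> nat) set" where
  "DI n = {\<alpha> \<in> partial_transformations n.
     \<forall>x \<in> dom \<alpha>. \<forall>y \<in> dom \<alpha>. cycle_dist n (the (\<alpha> x)) (the (\<alpha> y)) = cycle_dist n x y}"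

definition order_preserving :: "(nat \<rightharpoonup> nat) \<Rightarrow> bool" where
  "order_preserving \<alpha> \<longleftrightarrow>
     (\<forall>x \<in> dom \<alpha>. \<forall>y \<in> dom \<alpha>. x \<le> y \<longrightarrow> the (\<alpha> x) \<le> the (\<alpha> y))"

text \<open>Indices are 0-based; the successor of the last index is the first one.\<close>

definition cyclic :: "nat list \<Rightarrow> bool" where
  "cyclic as \<longleftrightarrow> card {i. i < length as \<and> as ! i > as ! (Suc i mod length as)} \<le> 1"

definition orientation_preserving :: "(nat \<rightharpoonup> nat) \<Rightarrow> bool" where
  "orientation_preserving \<alpha> \<longleftrightarrow>
     cyclic (map (\<lambda>a. the (\<alpha> a)) (sorted_list_of_set (dom \<alpha>)))"

definition ODI :: "nat \<Rightarrow> (nat \<rightharpoonup> nat) set" where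
  "ODI n = {\<alpha> \<in> DI n. order_preserving \<alpha>}"

definition OPDI :: "nat \<Rightarrow> (nat \<rightharpoonup> nat) set" where
  "OPDI n = {\<alpha> \<in> DI n. orientation_preserving \<alpha>}"

lemma cycle_adj_sym: "(x, y) \<in> cycle_adj n \<Longrightarrow> (y, x) \<in> cycle_adj n"
  by (auto simp: cycle_adj_def)

lemma cycle_walk_sym: "(x, y) \<in> cycle_adj n ^^ k \<Longrightarrow> (y, x) \<in> cycle_adj n ^^ k"
proof (induction k arbitrary: y)
  case (Suc k)
  then obtain z where "(x, z) \<in> cycle_adj n ^^ k" "(z, y) \<in> cycle_adj n" by auto
  then show ?case by (meson Suc.IH cycle_adj_sym relpow_Suc_I2)
qed auto

lemma cycle_walk_up:
  "1 \<le> x \<Longrightarrow> x + k \<le> n \<Longrightarrow> (x, x + k) \<in> cycle_adj n ^^ k"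
proof (induction k)
  case (Suc k)
  then have "(x, x + k) \<in> cycle_adj n ^^ k" by simp
  moreover have "(x + k, x + Suc k) \<in> cycle_adj n"
    using Suc.prems by (auto simp: cycle_adj_def Omega_def)
  ultimately show ?case by (rule relpow_Suc_I)
qed auto

lemma cycle_walk_lower:
  assumes "x \<in> Omega n" "(x, y) \<in> cycle_adj n ^^ k"
  shows "y \<in> Omega n \<and> min \<bar>int x - int y\<bar> (int n - \<bar>int x - int y\<bar>) \<le> int k"
  using assms(2)
proof (induction k arbitrary: y)
  case 0
  then show ?case using assms(1) by (auto simp: Omega_def)
next
  case (Suc k)
  then obtain z where "(x, z) \<in> cycle_adj n ^^ k" and z: "(z, y) \<in> cycle_adj n" by auto
  then have "z \<in> Omega n" and
    IH: "\<bar>int x - int z\<bar> \<le> int k \<or> int n - \<bar>int x - int z\<bar> \<le> int k"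
    using Suc.IH[of z] by (auto simp: min_le_iff_disj)
  moreover have "1 \<le> x" "x \<le> n" "1 \<le> z" "z \<le> n" "1 \<le> y" "y \<le> n"
    using \<open>z \<in> Omega n\<close> z assms(1) by (auto simp: cycle_adj_def Omega_def)
  moreover from z consider "y = z + 1" | "z = y + 1" | "z = 1" "y = n" | "z = n" "y = 1"
    by (auto simp: cycle_adj_def)
  then have "\<bar>int x - int y\<bar> \<le> int (Suc k) \<or> int n - \<bar>int x - int y\<bar> \<le> int (Suc k)"
    by cases (use IH calculation in \<open>auto simp: abs_if split: if_splits\<close>)
  ultimately show ?case by (auto simp: Omega_def min_le_iff_disj)
qed

lemma cycle_dist_commute: "cycle_dist n x y = cycle_dist n y x"
  unfolding cycle_dist_def by (metis cycle_walk_sym)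

lemma cycle_dist_eq:
  assumes "x \<in> Omega n" "y \<in> Omega n"
  shows "int (cycle_dist n x y) = min \<bar>int x - int y\<bar> (int n - \<bar>int x - int y\<bar>)"
  using assms
proof (induction x y rule: linorder_wlog)
  case (le x y)
  have xy: "1 \<le> x" "x \<le> n" "1 \<le> y" "y \<le> n" using le by (auto simp: Omega_def)
  have up: "(a, b) \<in> cycle_adj n ^^ (b - a)" if "1 \<le> a" "a \<le> b" "b \<le> n" for a b
    using cycle_walk_up[of a "b - a" n] that by (metis le_add_diff_inverse)
  have 1: "(x, y) \<in> cycle_adj n ^^ (y - x)"
    using xy(1) le(1) xy(4) by (rule up)
  have "(x, 1) \<in> cycle_adj n ^^ (x - 1)"
    by (rule cycle_walk_sym, rule up) (use xy in auto)
  moreover have "(1, n) \<in> cycle_adj n" using xy le by (auto simp: cycle_adj_def Omega_def)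
  ultimately have "(x, n) \<in> cycle_adj n ^^ Suc (x - 1)" by (rule relpow_Suc_I)
  moreover have "(n, y) \<in> cycle_adj n ^^ (n - y)"
    by (rule cycle_walk_sym, rule up) (use xy in auto)
  ultimately have "(x, y) \<in> cycle_adj n ^^ (Suc (x - 1) + (n - y))"
    unfolding relpow_add by (rule relcompI)
  moreover have "Suc (x - 1) + (n - y) = n - (y - x)" using xy le(1) by linarith
  ultimately have 2: "(x, y) \<in> cycle_adj n ^^ (n - (y - x))" by metis
  have "cycle_dist n x y \<le> y - x" "cycle_dist n x y \<le> n - (y - x)"
    unfolding cycle_dist_def by (rule Least_le, rule 1) (rule Least_le, rule 2)
  then have "int (cycle_dist n x y) \<le> min \<bar>int x - int y\<bar> (int n - \<bar>int x - int y\<bar>)"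
    using xy le(1) by linarith
  moreover have "(x, y) \<in> cycle_adj n ^^ cycle_dist n x y"
    unfolding cycle_dist_def using 1 by (rule LeastI)
  then have "min \<bar>int x - int y\<bar> (int n - \<bar>int x - int y\<bar>) \<le> int (cycle_dist n x y)"
    using cycle_walk_lower le by blast
  ultimately show ?case by (rule antisym)
next
  case (sym x y)
  then show ?case by (simp add: cycle_dist_commute[of n y x] abs_minus_commute)
qed

end

theory Submission
  imports Defs
begin

text \<open>An orientation-preserving partial isometry is empty, a restriction of one of the \<open>n\<close> rotations, or
  a restriction of a reflection to two points: on three or more points orientation excludes
  reflections. A reflection on two points agrees with a rotation exactly when the points are
  antipodal. So \<open>OPDI n\<close> consists of the empty map, \<open>n (2^n - 1)\<close> nonempty restrictions of
  rotations, and \<open>n\<close> reflections for each non-antipodal pair.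
  For \<open>ODI n\<close>, the rotation by \<open>k\<close> preserves the order exactly on subsets of \<open>{1..n - k}\<close> and of
  \<open>{n - k + 1..n}\<close>, and among the \<open>n\<close> reflections \<open>x \<mapsto> s - x\<close> of a pair \<open>x < y\<close>
  exactly the \<open>y - x\<close> ones with \<open>x < s \<le> y\<close> do.\<close>

section \<open>Rotations, reflections and families of their restrictions\<close>

text \<open>The residue of \<open>x + k\<close> modulo \<open>n\<close>, represented in
  \<open>{1..n}\<close> for \<open>x\<close> in that range and \<open>k < n\<close>.\<close>

definition rotation :: "nat \<Rightarrow> nat \<Rightarrow> nat \<Rightarrow> nat" where
  "rotation n k x = (if x + k \<le> n then x + k else x + k - n)"

text \<open>The residue of \<open>s - x\<close> modulo \<open>n\<close>, represented in
  \<open>{1..n}\<close> for \<open>s\<close> and \<open>x\<close> in that range. The point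
  \<open>s\<close> itself goes to \<open>n\<close>, hence the strict comparison.\<close>

definition reflection :: "nat \<Rightarrow> nat \<Rightarrow> nat \<Rightarrow> nat" where
  "reflection n s x = (if x < s then s - x else s + n - x)"

text \<open>The admissible domains \<open>S i\<close> may vary with the index, because the domains
  on which a rotation or reflection preserves the order depend on \<open>k\<close> or
  \<open>s\<close>.\<close>

definition restrictions :: "('i \<Rightarrow> 'a \<Rightarrow> 'b) \<Rightarrow> 'i set \<Rightarrow> ('i \<Rightarrow> 'a set set) \<Rightarrow> ('a \<rightharpoonup> 'b) set" where
  "restrictions f I S = (\<lambda>(i, A). (Some \<circ> f i) |` A) ` Sigma I S"

definition nonantipodal :: "nat \<Rightarrow> (nat \<times> nat) set" where
  "nonantipodal n = {(x, y). 1 \<le> x \<and> x < y \<and> y \<le> n \<and> 2 * (y - x) \<noteq> n}"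

lemma finite_nonantipodal: "finite (nonantipodal n)"
  by (rule finite_subset[of _ "{1..n} \<times> {1..n}"]) (auto simp: nonantipodal_def)

definition pair_set :: "'a \<times> 'a \<Rightarrow> 'a set" where
  "pair_set p = {fst p, snd p}"

lemma dom_Some_comp [simp]: "dom (Some \<circ> f) = UNIV"
  by auto

lemma dom_Some_restrict: "dom ((Some \<circ> f) |` A) = A"
  by simp

lemma Some_restrict_cong: "(\<And>x. x \<in> dom \<alpha> \<Longrightarrow> the (\<alpha> x) = f x) \<Longrightarrow> \<alpha> = (Some \<circ> f) |` dom \<alpha>"
  by (rule ext) (force simp: restrict_map_def domIff)

lemma mem_restrictionsI:
  "i \<in> I \<Longrightarrow> dom \<alpha> \<in> S i \<Longrightarrow> (\<And>x. x \<in> dom \<alpha> \<Longrightarrow> the (\<alpha> x) = f i x) \<Longrightarrow> \<alpha> \<in> restrictions f I S"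
  unfolding restrictions_def by (rule image_eqI[of _ _ "(i, dom \<alpha>)"]) (auto intro: Some_restrict_cong)

lemma mem_restrictionsE:
  assumes "\<alpha> \<in> restrictions f I S"
  obtains i where "i \<in> I" "dom \<alpha> \<in> S i" "\<And>x. x \<in> dom \<alpha> \<Longrightarrow> the (\<alpha> x) = f i x"
  using assms unfolding restrictions_def by auto

text \<open>The domain of a restriction returns \<open>A\<close>, and by the last hypothesis its
  value at any one point of the nonempty set \<open>A\<close> returns \<open>i\<close>. So the pairs
  of index and domain parametrise the restrictions injectively.\<close>

lemma card_restrictions:
  assumes "finite I" "\<And>i. i \<in> I \<Longrightarrow> finite (S i)" "\<And>i. i \<in> I \<Longrightarrow> {} \<notin> S i"
    and "\<And>i j A x. i \<in> I \<Longrightarrow> j \<in> I \<Longrightarrow> A \<in> S i \<Longrightarrow> x \<in> A \<Longrightarrow> f i x = f j x \<Longrightarrow> i = j"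
  shows "card (restrictions f I S) = (\<Sum>i\<in>I. card (S i))"
proof -
  have "inj_on (\<lambda>(i, A). (Some \<circ> f i) |` A) (Sigma I S)"
  proof (intro inj_onI, clarify)
    fix i A j B assume *: "i \<in> I" "A \<in> S i" "j \<in> I" "B \<in> S j"
      and eq: "(Some \<circ> f i) |` A = (Some \<circ> f j) |` B"
    from arg_cong[OF eq, of dom] have "A = B" by (simp only: dom_Some_restrict)
    moreover obtain x where x: "x \<in> A" using * assms(3) by (metis all_not_in_conv)
    moreover have "f i x = f j x" using fun_cong[OF eq, of x] x \<open>A = B\<close> by simp
    ultimately show "i = j \<and> A = B" using * assms(4) by blast
  qed
  then show ?thesis unfolding restrictions_def using assms by (simp add: card_image)
qed

lemma finite_restrictions:
  "finite I \<Longrightarrow> (\<And>i. i \<in> I \<Longrightarrow> finite (S i)) \<Longrightarrow> finite (restrictions f I S)"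
  unfolding restrictions_def by auto

section \<open>Orientation as monotonicity on the two sides of a cut\<close>

text \<open>The image list descends at one cyclic position at most. Cutting the domain just after it
  leaves two blocks on which the map is monotone, and no value on the upper block exceeds a value on
  the lower one. List indices thus give way to linear inequalities between points.\<close>

lemma orientation_preservingD:
  assumes fin: "finite (dom \<alpha>)" and op: "orientation_preserving \<alpha>"
  obtains c where "\<And>x y. x \<in> dom \<alpha> \<Longrightarrow> y \<in> dom \<alpha> \<Longrightarrow> x < y \<Longrightarrow>
    (if x < c \<and> c \<le> y then the (\<alpha> y) \<le> the (\<alpha> x) else the (\<alpha> x) \<le> the (\<alpha> y))"
proof (cases "dom \<alpha> = {}")
  case True
  then show ?thesis using that[of 0] by simp
next
  case False
  define xs where "xs = sorted_list_of_set (dom \<alpha>)"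
  define t where "t = length xs"
  define a where "a i = the (\<alpha> (xs ! i))" for i
  define D where "D = {i. i < t \<and> a i > a (Suc i mod t)}"
  have set: "set xs = dom \<alpha>" and sorted: "sorted_wrt (<) xs"
    unfolding xs_def using fin by auto
  have "t > 0" unfolding t_def using set False by (metis length_greater_0_conv set_empty)
  then have mt: "Suc i mod t < t" for i by simp
  have "{i. i < t \<and> map (\<lambda>x. the (\<alpha> x)) xs ! i > map (\<lambda>x. the (\<alpha> x)) xs ! (Suc i mod t)} = D"
    unfolding D_def using mt by (auto simp: a_def t_def)
  then have "card D \<le> 1"
    using op by (simp add: orientation_preserving_def cyclic_def t_def flip: xs_def)
  moreover have "finite D" by (simp add: D_def)
  ultimately have "\<forall>i\<in>D. \<forall>j\<in>D. i = j" by (simp add: card_le_Suc0_iff_eq)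
  \<comment> \<open>If there is no descent, \<open>m = 0\<close> is taken, a valid index because
    \<open>t > 0\<close>.\<close>
  then obtain m where m: "m < t" "D \<subseteq> {m}"
  proof (cases "D = {}")
    case True
    then show ?thesis using that[of 0] \<open>t > 0\<close> by simp
  next
    case False
    then obtain m where "m \<in> D" by blast
    then show ?thesis using that[of m] \<open>\<forall>i\<in>D. \<forall>j\<in>D. i = j\<close> by (auto simp: D_def)
  qed
  have step: "a i \<le> a (Suc i)" if "Suc i < t" "i \<noteq> m" for i
  proof -
    have "i \<notin> D" using that m by blast
    then show ?thesis using that by (simp add: D_def)
  qed
  have chain: "i + d < t \<Longrightarrow> \<not> (i \<le> m \<and> m < i + d) \<Longrightarrow> a i \<le> a (i + d)" for i d
  proof (induction d)
    case (Suc d)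
    then have "a i \<le> a (i + d)" by auto
    also have "\<dots> \<le> a (Suc (i + d))" using Suc.prems by (intro step) auto
    finally show ?case by simp
  qed simp
  have chain': "a i \<le> a j" if "i \<le> j" "j < t" "\<not> (i \<le> m \<and> m < j)" for i j
    using chain[of i "j - i"] that by simp
  \<comment> \<open>Across the cut the comparison runs cyclically: from \<open>j\<close> up to the
    last index, over the wrap to \<open>0\<close>, then up to \<open>i\<close>. This route avoids
    the step at \<open>m\<close>.\<close>
  have wrap: "a j \<le> a i" if "i \<le> m" "m < j" "j < t" for i j
  proof -
    have "a j \<le> a (t - 1)" using that by (intro chain') auto
    also have "t - 1 \<notin> D" using that m by auto
    then have "a (t - 1) \<le> a 0" using \<open>t > 0\<close> by (auto simp: D_def)
    also have "a 0 \<le> a i" using that by (intro chain') auto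
    finally show ?thesis .
  qed
  have less_iff: "xs ! i < xs ! j \<longleftrightarrow> i < j" if "i < t" "j < t" for i j
    using sorted that unfolding t_def
    by (metis linorder_neqE_nat not_less_iff_gr_or_eq sorted_wrt_nth_less)
  show ?thesis
  \<comment> \<open>The successor puts the point at position \<open>m\<close> itself below the
    cut.\<close>
  proof (rule that[of "Suc (xs ! m)"])
    fix x y assume "x \<in> dom \<alpha>" "y \<in> dom \<alpha>" and less: "x < y"
    then obtain i j where ij: "i < t" "j < t" "x = xs ! i" "y = xs ! j"
      using set by (metis in_set_conv_nth t_def)
    have "i < j" using less ij less_iff by blast
    moreover have "x < Suc (xs ! m) \<longleftrightarrow> i \<le> m"
      using less_iff[of m i] ij m by auto
    moreover have "Suc (xs ! m) \<le> y \<longleftrightarrow> m < j"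
      using less_iff[of m j] ij m by auto
    ultimately show "if x < Suc (xs ! m) \<and> Suc (xs ! m) \<le> y
      then the (\<alpha> y) \<le> the (\<alpha> x) else the (\<alpha> x) \<le> the (\<alpha> y)"
      using chain'[of i j] wrap[of i j] ij by (auto simp: a_def)
  qed
qed

text \<open>A descent between neighbours must straddle \<open>c\<close>, and a descent from the last
  point back to the first needs all points on one side of \<open>c\<close>. As the points increase,
  two different descents cannot coexist.\<close>

lemma orientation_preservingI:
  assumes fin: "finite (dom \<alpha>)"
    and c: "\<And>x y. x \<in> dom \<alpha> \<Longrightarrow> y \<in> dom \<alpha> \<Longrightarrow> x < y \<Longrightarrow>
    (if x < c \<and> c \<le> y then the (\<alpha> y) \<le> the (\<alpha> x) else the (\<alpha> x) \<le> the (\<alpha> y))"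
  shows "orientation_preserving \<alpha>"
proof -
  define xs where "xs = sorted_list_of_set (dom \<alpha>)"
  define t where "t = length xs"
  define a where "a i = the (\<alpha> (xs ! i))" for i
  define D where "D = {i. i < t \<and> a i > a (Suc i mod t)}"
  have set: "set xs = dom \<alpha>" and sorted: "sorted_wrt (<) xs"
    unfolding xs_def using fin by auto
  have mt: "i < t \<Longrightarrow> Suc i mod t < t" for i by simp
  have less: "xs ! i < xs ! j" if "i < j" "j < t" for i j
    using sorted that unfolding t_def by (simp add: sorted_wrt_nth_less)
  have le: "xs ! i \<le> xs ! j" if "i \<le> j" "j < t" for i j
    using less[of i j] that by (cases "i = j") auto
  have dom: "xs ! i \<in> dom \<alpha>" if "i < t" for i using that set t_def by auto
  have inner: "xs ! i < c \<and> c \<le> xs ! Suc i" if "i \<in> D" "Suc i < t" for i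
    using c[OF dom dom less, of i "Suc i"] that by (auto simp: D_def a_def split: if_splits)
  have last: "c \<le> xs ! 0 \<or> xs ! i < c" if "i \<in> D" "Suc i = t" for i
  proof (cases "i = 0")
    case False
    then show ?thesis
      using c[OF dom dom less, of 0 i] that by (auto simp: D_def a_def split: if_splits)
  qed (use that in auto)
  have not_less: "\<not> i < j" if "i \<in> D" "j \<in> D" for i j
  proof
    assume ij: "i < j"
    have "j < t" using that by (simp add: D_def)
    then have i: "xs ! i < c" "c \<le> xs ! Suc i" using inner[of i] that ij by auto
    have *: "xs ! 0 \<le> xs ! i" "xs ! Suc i \<le> xs ! j" using le ij \<open>j < t\<close> by auto
    show False
    proof (cases "Suc j < t")
      case True
      then show False using inner[of j] that i * by auto
    next
      case False
      then have "Suc j = t" using \<open>j < t\<close> by simp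
      then show False using last[of j] that i * by auto
    qed
  qed
  have "{i. i < t \<and> map (\<lambda>x. the (\<alpha> x)) xs ! i > map (\<lambda>x. the (\<alpha> x)) xs ! (Suc i mod t)} = D"
    unfolding D_def using mt by (auto simp: a_def t_def)
  moreover have "finite D" by (simp add: D_def)
  then have "card D \<le> 1"
    using not_less by (simp add: card_le_Suc0_iff_eq) (metis linorder_neqE_nat)
  ultimately show ?thesis by (simp add: orientation_preserving_def cyclic_def t_def flip: xs_def)
qed

section \<open>Partial isometries through absolute differences\<close>

text \<open>The number \<open>min d (n - d)\<close> determines \<open>d\<close> up to exchange with
  \<open>n - d\<close>, so equality of distances becomes a disjunction of linear equations.\<close>

lemma cycle_dist_eq_iff:
  assumes "u \<in> Omega n" "v \<in> Omega n" "x \<in> Omega n" "y \<in> Omega n"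
  shows "cycle_dist n u v = cycle_dist n x y \<longleftrightarrow>
    \<bar>int u - int v\<bar> = \<bar>int x - int y\<bar> \<or> \<bar>int u - int v\<bar> = int n - \<bar>int x - int y\<bar>"
proof -
  have "cycle_dist n u v = cycle_dist n x y \<longleftrightarrow> int (cycle_dist n u v) = int (cycle_dist n x y)"
    by simp
  then show ?thesis unfolding cycle_dist_eq[OF assms(1,2)] cycle_dist_eq[OF assms(3,4)]
    by linarith
qed

lemma DI_finite_dom: "\<alpha> \<in> DI n \<Longrightarrow> finite (dom \<alpha>)"
  by (auto simp: DI_def partial_transformations_def Omega_def intro: finite_subset)

lemma DI_mem:
  assumes "\<alpha> \<in> DI n" "x \<in> dom \<alpha>"
  shows "1 \<le> x" "x \<le> n" "1 \<le> the (\<alpha> x)" "the (\<alpha> x) \<le> n"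
  using assms by (auto simp: DI_def partial_transformations_def Omega_def dom_def ran_def)

lemma DI_dist:
  assumes "\<alpha> \<in> DI n" "x \<in> dom \<alpha>" "y \<in> dom \<alpha>"
  shows "\<bar>int (the (\<alpha> x)) - int (the (\<alpha> y))\<bar> = \<bar>int x - int y\<bar> \<or>
    \<bar>int (the (\<alpha> x)) - int (the (\<alpha> y))\<bar> = int n - \<bar>int x - int y\<bar>"
proof -
  have "the (\<alpha> x) \<in> Omega n" "the (\<alpha> y) \<in> Omega n" "x \<in> Omega n" "y \<in> Omega n"
    using DI_mem[OF assms(1,2)] DI_mem[OF assms(1,3)] by (auto simp: Omega_def)
  moreover have "cycle_dist n (the (\<alpha> x)) (the (\<alpha> y)) = cycle_dist n x y"
    using assms by (simp add: DI_def)
  ultimately show ?thesis by (simp add: cycle_dist_eq_iff)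
qed

lemma DI_restrictI:
  assumes "A \<subseteq> Omega n" "f ` A \<subseteq> Omega n"
    and "\<And>x y. x \<in> A \<Longrightarrow> y \<in> A \<Longrightarrow> x < y \<Longrightarrow> 
      \<bar>int (f x) - int (f y)\<bar> = int y - int x \<or> \<bar>int (f x) - int (f y)\<bar> = int n - (int y - int x)"
  shows "(Some \<circ> f) |` A \<in> DI n"
proof -
  have "cycle_dist n (f x) (f y) = cycle_dist n x y" if xy: "x \<in> A" "y \<in> A" for x y
  proof -
    have "\<bar>int (f x) - int (f y)\<bar> = \<bar>int x - int y\<bar> \<or> \<bar>int (f x) - int (f y)\<bar> = int n - \<bar>int x - int y\<bar>"
      using xy assms(3)[of x y] assms(3)[of y x] by (cases x y rule: linorder_cases) auto
    then show ?thesis using assms(1,2) xy by (subst cycle_dist_eq_iff) auto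
  qed
  moreover have "ran ((Some \<circ> f) |` A) \<subseteq> Omega n"
    using assms(2) by (auto simp: ran_def restrict_map_def split: if_splits)
  ultimately show ?thesis using assms(1) by (auto simp: DI_def partial_transformations_def)
qed

section \<open>Classification of the orientation-preserving partial isometries\<close>

text \<open>An orientation-preserving map sends three points to three points in the same cyclic order, so
  the three gaps and the three image gaps both sum to \<open>n\<close>; as each image gap is the gap or its
  complement in \<open>n\<close>, all gaps are preserved.\<close>

lemma OPDI_triple:
  assumes "\<alpha> \<in> OPDI n" "x \<in> dom \<alpha>" "y \<in> dom \<alpha>" "z \<in> dom \<alpha>" "x < y" "y < z"
  defines "u \<equiv> int (the (\<alpha> x))" and "v \<equiv> int (the (\<alpha> y))" and "w \<equiv> int (the (\<alpha> z))"
  shows "v - u \<in> {int y - int x, int y - int x - int n}"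
    "w - v \<in> {int z - int y, int z - int y - int n}"
    "w - u \<in> {int z - int x, int z - int x - int n}"
proof -
  have DI: "\<alpha> \<in> DI n" and op: "orientation_preserving \<alpha>" using assms(1) by (auto simp: OPDI_def)
  obtain c where c: "\<And>x y. x \<in> dom \<alpha> \<Longrightarrow> y \<in> dom \<alpha> \<Longrightarrow> x < y \<Longrightarrow>
    (if x < c \<and> c \<le> y then the (\<alpha> y) \<le> the (\<alpha> x) else the (\<alpha> x) \<le> the (\<alpha> y))"
    using orientation_preservingD[OF DI_finite_dom[OF DI] op] by blast
  have cyc: "u \<le> v \<and> v \<le> w \<or> v \<le> w \<and> w \<le> u \<or> w \<le> u \<and> u \<le> v"
    using c[of x y] c[of y z] c[of x z] assms(2-6) unfolding u_def v_def w_def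
    by (auto split: if_splits)
  have d: "\<bar>u - v\<bar> = int y - int x \<or> \<bar>u - v\<bar> = int n - (int y - int x)"
    "\<bar>v - w\<bar> = int z - int y \<or> \<bar>v - w\<bar> = int n - (int z - int y)"
    "\<bar>u - w\<bar> = int z - int x \<or> \<bar>u - w\<bar> = int n - (int z - int x)"
    using DI_dist[OF DI, of x y] DI_dist[OF DI, of y z] DI_dist[OF DI, of x z] assms(2-6)
    unfolding u_def v_def w_def by auto
  have m: "int x \<ge> 1" "int z \<le> int n" "int x < int y" "int y < int z"
    using DI_mem[OF DI] assms(2-6) by auto
  show "v - u \<in> {int y - int x, int y - int x - int n}"
    "w - v \<in> {int z - int y, int z - int y - int n}"
    "w - u \<in> {int z - int x, int z - int x - int n}"
    unfolding insert_iff empty_iff using cyc d m by smt+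
qed

lemma rotation_restrict_mem_OPDI:
  assumes "k < n" "A \<subseteq> Omega n"
  shows "(Some \<circ> rotation n k) |` A \<in> OPDI n"
proof -
  have A: "1 \<le> x \<and> x \<le> n" if "x \<in> A" for x using assms that by (auto simp: Omega_def)
  have "(Some \<circ> rotation n k) |` A \<in> DI n"
    using assms A by (intro DI_restrictI) (fastforce simp: rotation_def Omega_def)+
  moreover have "orientation_preserving ((Some \<circ> rotation n k) |` A)"
  \<comment> \<open>The cut is the first point that the rotation wraps past \<open>n\<close>; for
    \<open>k = 0\<close> it exceeds \<open>n\<close> and separates nothing.\<close>
  proof (rule orientation_preservingI[where c = "n - k + 1"])
    show "finite (dom ((Some \<circ> rotation n k) |` A))"
      using assms by (auto simp: Omega_def intro: finite_subset)
  next
    fix x y assume "x \<in> dom ((Some \<circ> rotation n k) |` A)" "y \<in> dom ((Some \<circ> rotation n k) |` A)" "x < y"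
    then show "if x < n - k + 1 \<and> n - k + 1 \<le> y
      then the (((Some \<circ> rotation n k) |` A) y) \<le> the (((Some \<circ> rotation n k) |` A) x)
      else the (((Some \<circ> rotation n k) |` A) x) \<le> the (((Some \<circ> rotation n k) |` A) y)"
      using A[of x] A[of y] assms(1) by (auto simp: rotation_def)
  qed
  ultimately show ?thesis by (simp add: OPDI_def)
qed

lemma reflection_restrict_mem_OPDI:
  assumes "s \<in> {1..n}" "p \<in> nonantipodal n"
  shows "(Some \<circ> reflection n s) |` pair_set p \<in> OPDI n"
proof -
  let ?f = "reflection n s"
  obtain x y where p: "p = (x, y)" "1 \<le> x" "x < y" "y \<le> n"
    using assms(2) by (auto simp: nonantipodal_def)
  have A: "pair_set p = {x, y}" by (simp add: p pair_set_def)
  have "(Some \<circ> ?f) |` {x, y} \<in> DI n"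
    using assms(1) p by (intro DI_restrictI) (auto simp: reflection_def Omega_def)
  moreover have "orientation_preserving ((Some \<circ> ?f) |` {x, y})"
    \<comment> \<open>Two points admit a cut whatever their images are: between them if the values
      do not ascend, and otherwise at \<open>0\<close>, below every point.\<close>
    by (rule orientation_preservingI[where c = "if ?f y \<le> ?f x then y else 0"]) (use p in auto)
  ultimately show ?thesis unfolding A by (simp add: OPDI_def)
qed

text \<open>If all differences are preserved modulo \<open>n\<close>, the map is a rotation. A pair
  violating this admits no third point in the domain, by \<open>OPDI_triple\<close>, and its two
  points then have constant sum with their images modulo \<open>n\<close>.\<close>

lemma OPDI_cases:
  assumes "\<alpha> \<in> OPDI n" "\<alpha> \<noteq> Map.empty"
  obtains (rotation) k where "k < n" "\<And>x. x \<in> dom \<alpha> \<Longrightarrow> the (\<alpha> x) = rotation n k x"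
  | (reflection) s p where "s \<in> {1..n}" "p \<in> nonantipodal n" "dom \<alpha> = pair_set p"
      "\<And>x. x \<in> dom \<alpha> \<Longrightarrow> the (\<alpha> x) = reflection n s x"
proof -
  define g where "g x = int (the (\<alpha> x))" for x
  have DI: "\<alpha> \<in> DI n" using assms(1) by (simp add: OPDI_def)
  have mem: "1 \<le> x" "x \<le> n" "1 \<le> the (\<alpha> x)" "the (\<alpha> x) \<le> n" if "x \<in> dom \<alpha>" for x
    using DI_mem[OF DI that] .
  show thesis
  proof (cases "\<forall>x\<in>dom \<alpha>. \<forall>y\<in>dom \<alpha>. x < y \<longrightarrow> g y - g x \<in> {int y - int x, int y - int x - int n}")
    case True
    obtain z where z: "z \<in> dom \<alpha>" using assms(2) by auto
    \<comment> \<open>The residue in \<open>{0..<n}\<close> of the displacement at an arbitrary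
      point \<open>z\<close> of the domain.\<close>
    define k where "k = (if z \<le> the (\<alpha> z) then the (\<alpha> z) - z else the (\<alpha> z) + n - z)"
    have "k < n" using mem[OF z] by (auto simp: k_def)
    moreover have "the (\<alpha> x) = rotation n k x" if x: "x \<in> dom \<alpha>" for x
    proof (cases x z rule: linorder_cases)
      case less
      then have "g z - g x \<in> {int z - int x, int z - int x - int n}" using True x z by blast
      then show ?thesis using mem[OF x] mem[OF z] less
        unfolding g_def k_def rotation_def by (auto split: if_splits)
    next
      case equal
      then show ?thesis using mem[OF z] unfolding k_def rotation_def by auto
    next
      case greater
      then have "g x - g z \<in> {int x - int z, int x - int z - int n}" using True x z by blast
      then show ?thesis using mem[OF x] mem[OF z] greater
        unfolding g_def k_def rotation_def by (auto split: if_splits)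
    qed
    ultimately show thesis by (rule rotation)
  next
    case False
    then obtain x y where xy: "x \<in> dom \<alpha>" "y \<in> dom \<alpha>" "x < y"
      and not: "g y - g x \<notin> {int y - int x, int y - int x - int n}" by blast
    \<comment> \<open>Wherever a third point lies relative to \<open>x\<close> and \<open>y\<close>,
      \<open>OPDI_triple\<close> puts \<open>g y - g x\<close> into the excluded set.\<close>
    have "z \<in> {x, y}" if "z \<in> dom \<alpha>" for z
    proof (rule ccontr)
      assume "z \<notin> {x, y}"
      then consider "z < x" | "x < z" "z < y" | "y < z" by fastforce
      then show False
        using OPDI_triple[OF assms(1)] xy not that unfolding g_def by cases metis+
    qed
    then have dom: "dom \<alpha> = {x, y}" using xy by blast
    define s where "s = (if x + the (\<alpha> x) \<le> n then x + the (\<alpha> x) else x + the (\<alpha> x) - n)"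
    note m = mem[OF xy(1)] mem[OF xy(2)]
    have d: "\<bar>g y - g x\<bar> = int y - int x \<or> \<bar>g y - g x\<bar> = int n - (int y - int x)"
      using DI_dist[OF DI xy(1,2)] xy(3) unfolding g_def by auto
    show thesis
    proof (rule reflection[of s "(x, y)"])
      show "s \<in> {1..n}" using m by (auto simp: s_def)
      \<comment> \<open>For an antipodal pair \<open>n - (y - x)\<close> equals
        \<open>y - x\<close>, so every value allowed by \<open>d\<close> would lie in the excluded
        set.\<close>
      show "(x, y) \<in> nonantipodal n"
        using m xy(3) d not unfolding nonantipodal_def g_def by auto
      show "dom \<alpha> = pair_set (x, y)" using dom by (simp add: pair_set_def)
      fix z assume "z \<in> dom \<alpha>"
      then consider "z = x" | "z = y" using dom by blast
      then show "the (\<alpha> z) = reflection n s z"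
      proof cases
        case 1
        then show ?thesis using m unfolding s_def reflection_def by auto
      next
        case 2
        \<comment> \<open>Of the four signed values allowed by \<open>d\<close>, only
          \<open>-(y - x)\<close> and \<open>n - (y - x)\<close> survive \<open>not\<close>.\<close>
        have "the (\<alpha> y) + y = the (\<alpha> x) + x \<or> the (\<alpha> y) + y = the (\<alpha> x) + x + n"
          using d not unfolding g_def insert_iff empty_iff by linarith
        then show ?thesis using m xy(3) 2 unfolding s_def reflection_def by auto
      qed
    qed
  qed
qed

text \<open>The empty map restricts every rotation and reflection; listing it apart keeps the
  domains nonempty, as \<open>card_restrictions\<close> requires.\<close>

lemma OPDI_eq:
  "OPDI n = insert Map.empty (restrictions (rotation n) {0..<n} (\<lambda>_. Pow (Omega n) - {{}})
     \<union> restrictions (reflection n) {1..n} (\<lambda>_. pair_set ` nonantipodal n))" (is "_ = insert _ (?R \<union> ?F)")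
proof (intro subset_antisym subsetI)
  fix \<alpha> assume \<alpha>: "\<alpha> \<in> OPDI n"
  show "\<alpha> \<in> insert Map.empty (?R \<union> ?F)"
  proof (cases "\<alpha> = Map.empty")
    case False
    have "dom \<alpha> \<in> Pow (Omega n) - {{}}"
      using \<alpha> False by (auto simp: OPDI_def DI_def partial_transformations_def)
    with \<alpha> False show ?thesis
      by (cases rule: OPDI_cases) (auto intro!: mem_restrictionsI)
  qed simp
next
  fix \<alpha> assume "\<alpha> \<in> insert Map.empty (?R \<union> ?F)"
  then consider "\<alpha> = Map.empty" | "\<alpha> \<in> ?R" | "\<alpha> \<in> ?F" by blast
  then show "\<alpha> \<in> OPDI n"
  proof cases
    case 1
    then show ?thesis
      by (auto simp: OPDI_def DI_def partial_transformations_def intro: orientation_preservingI)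
  next
    case 2
    then show ?thesis by (auto simp: restrictions_def intro!: rotation_restrict_mem_OPDI)
  next
    case 3
    then show ?thesis by (auto simp: restrictions_def intro!: reflection_restrict_mem_OPDI)
  qed
qed

section \<open>The order-preserving restrictions\<close>

text \<open>The rotation increases on each of the two blocks and sends the upper block below the
  image of the lower one. So the order fails exactly when \<open>A\<close> meets both.\<close>

lemma rotation_restrict_order_preserving_iff:
  assumes "k < n" "A \<subseteq> Omega n"
  shows "order_preserving ((Some \<circ> rotation n k) |` A) \<longleftrightarrow> A \<subseteq> {1..n - k} \<or> A \<subseteq> {n - k + 1..n}"
proof -
  have A: "1 \<le> x" "x \<le> n" if "x \<in> A" for x using assms that by (auto simp: Omega_def)
  have "order_preserving ((Some \<circ> rotation n k) |` A) \<longleftrightarrow>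
      (\<forall>x\<in>A. \<forall>y\<in>A. x \<le> y \<longrightarrow> rotation n k x \<le> rotation n k y)"
    by (simp add: order_preserving_def)
  also have "\<dots> \<longleftrightarrow> (\<forall>x\<in>A. \<forall>y\<in>A. x \<le> n - k \<longrightarrow> y \<le> n - k)"
  proof
    assume *: "\<forall>x\<in>A. \<forall>y\<in>A. x \<le> y \<longrightarrow> rotation n k x \<le> rotation n k y"
    show "\<forall>x\<in>A. \<forall>y\<in>A. x \<le> n - k \<longrightarrow> y \<le> n - k"
    proof (intro ballI impI, rule ccontr)
      fix x y assume xy: "x \<in> A" "y \<in> A" "x \<le> n - k" "\<not> y \<le> n - k"
      then have "rotation n k x \<le> rotation n k y" using * by simp
      then show False using xy A[of x] A[of y] assms(1) by (simp add: rotation_def split: if_splits)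
    qed
  next
    assume *: "\<forall>x\<in>A. \<forall>y\<in>A. x \<le> n - k \<longrightarrow> y \<le> n - k"
    show "\<forall>x\<in>A. \<forall>y\<in>A. x \<le> y \<longrightarrow> rotation n k x \<le> rotation n k y"
    proof (intro ballI impI)
      fix x y assume xy: "x \<in> A" "y \<in> A" "x \<le> y"
      then have "x \<le> n - k \<longrightarrow> y \<le> n - k" using * by blast
      then show "rotation n k x \<le> rotation n k y" using xy A[of x] A[of y] assms(1)
        by (auto simp: rotation_def)
    qed
  qed
  also have "\<dots> \<longleftrightarrow> A \<subseteq> {1..n - k} \<or> A \<subseteq> {n - k + 1..n}"
    using A by (force simp: subset_iff not_le)
  finally show ?thesis .
qed

text \<open>If \<open>s\<close> separates the points, only the image of \<open>y\<close> receives
  the extra \<open>n\<close>, and \<open>y - x < n\<close> gives the order. Otherwise both points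
  use the same branch, which is decreasing.\<close>

lemma reflection_restrict_order_preserving_iff:
  assumes "s \<in> {1..n}" "(x, y) \<in> nonantipodal n"
  shows "order_preserving ((Some \<circ> reflection n s) |` pair_set (x, y)) \<longleftrightarrow> x < s \<and> s \<le> y"
  using assms by (auto simp: order_preserving_def pair_set_def reflection_def nonantipodal_def)

lemma restrictions_Collect:
  "{\<alpha> \<in> restrictions f I S. P \<alpha>} = restrictions f I (\<lambda>i. {A \<in> S i. P ((Some \<circ> f i) |` A)})"
  by (auto simp: restrictions_def)

lemma restrictions_cong:
  "(\<And>i. i \<in> I \<Longrightarrow> S i = T i) \<Longrightarrow> restrictions f I S = restrictions f I T"
  unfolding restrictions_def by (metis (no_types, lifting) Sigma_cong)

text \<open>This lets \<open>ODI n\<close> be read off by filtering the classification of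
  \<open>OPDI n\<close>. A monotone map meets the cut criterion with cut \<open>0\<close>.\<close>

lemma ODI_eq_OPDI: "ODI n = {\<alpha> \<in> OPDI n. order_preserving \<alpha>}"
proof -
  have "orientation_preserving \<alpha>" if "\<alpha> \<in> DI n" "order_preserving \<alpha>" for \<alpha>
    by (rule orientation_preservingI[OF DI_finite_dom[OF that(1)], of 0])
      (use that(2) in \<open>auto simp: order_preserving_def\<close>)
  then show ?thesis by (auto simp: ODI_def OPDI_def)
qed

lemma ODI_eq:
  "ODI n = insert Map.empty
     (restrictions (rotation n) {0..<n} (\<lambda>k. (Pow {1..n - k} - {{}}) \<union> (Pow {n - k + 1..n} - {{}}))
     \<union> restrictions (reflection n) {1..n}
         (\<lambda>s. pair_set ` {(x, y). (x, y) \<in> nonantipodal n \<and> x < s \<and> s \<le> y}))"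
    (is "_ = insert _ (restrictions _ _ ?S \<union> restrictions _ _ ?T)")
proof -
  have S: "{A \<in> Pow (Omega n) - {{}}. order_preserving ((Some \<circ> rotation n k) |` A)} = ?S k"
    if "k \<in> {0..<n}" for k
  proof -
    have "{1..n - k} \<subseteq> Omega n" "{n - k + 1..n} \<subseteq> Omega n" by (auto simp: Omega_def)
    moreover have "k < n" using that by simp
    ultimately show ?thesis using rotation_restrict_order_preserving_iff[of k n] by blast
  qed
  have T: "{A \<in> pair_set ` nonantipodal n. order_preserving ((Some \<circ> reflection n s) |` A)} = ?T s"
    if "s \<in> {1..n}" for s
    using reflection_restrict_order_preserving_iff[OF that] by fast
  have "order_preserving Map.empty" by (simp add: order_preserving_def)
  then have "ODI n = insert Map.empty
    ({\<alpha> \<in> restrictions (rotation n) {0..<n} (\<lambda>_. Pow (Omega n) - {{}}). order_preserving \<alpha>} \<union>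
     {\<alpha> \<in> restrictions (reflection n) {1..n} (\<lambda>_. pair_set ` nonantipodal n). order_preserving \<alpha>})"
    unfolding ODI_eq_OPDI OPDI_eq by blast
  also have "\<dots> = insert Map.empty (restrictions (rotation n) {0..<n} ?S \<union> restrictions (reflection n) {1..n} ?T)"
    unfolding restrictions_Collect
    by (intro arg_cong2[where f = "(\<union>)"] arg_cong[where f = "insert Map.empty"] restrictions_cong S T)
  finally show ?thesis .
qed

section \<open>Counting restrictions of rotations and reflections together\<close>

text \<open>Stated for arbitrary families \<open>S\<close> and \<open>T\<close> so that one count
  serves both monoids. One value determines \<open>k\<close> or \<open>s\<close>, and the two kinds
  of restriction never coincide on a non-antipodal pair.\<close>

lemma card_rotation_reflection_union:
  assumes S: "\<And>k. k \<in> {0..<n} \<Longrightarrow> S k \<subseteq> Pow (Omega n) - {{}}"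
    and T: "\<And>s. s \<in> {1..n} \<Longrightarrow> T s \<subseteq> nonantipodal n"
  shows "card (insert Map.empty (restrictions (rotation n) {0..<n} S
      \<union> restrictions (reflection n) {1..n} (\<lambda>s. pair_set ` T s))) =
    1 + (\<Sum>k\<in>{0..<n}. card (S k)) + (\<Sum>s\<in>{1..n}. card (T s))"
    (is "card (insert _ (?R \<union> ?F)) = _")
proof -
  have S_mem: "1 \<le> x \<and> x \<le> n" if "k \<in> {0..<n}" "A \<in> S k" "x \<in> A" for k A x
    using S[OF that(1)] that by (force simp: Omega_def)
  have finS: "finite (S k)" if "k \<in> {0..<n}" for k
    using S[OF that] by (rule finite_subset) (simp add: Omega_def)
  have finT: "finite (T s)" if "s \<in> {1..n}" for s
    using T[OF that] finite_nonantipodal by (rule finite_subset)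
  have cardR: "card ?R = (\<Sum>k\<in>{0..<n}. card (S k))"
  proof (rule card_restrictions)
    fix i j A x assume *: "i \<in> {0..<n}" "j \<in> {0..<n}" "A \<in> S i" "x \<in> A" and "rotation n i x = rotation n j x"
    then show "i = j" using S_mem[OF *(1,3,4)] by (auto simp: rotation_def split: if_splits)
  qed (use finS S in auto)
  have inj: "inj_on pair_set (T s)" if "s \<in> {1..n}" for s
  proof (rule inj_onI)
    fix p q assume "p \<in> T s" "q \<in> T s" and eq: "pair_set p = pair_set q"
    then have "p \<in> nonantipodal n" "q \<in> nonantipodal n" using T[OF that] by blast+
    then show "p = q" using eq
      by (cases p; cases q) (auto simp: nonantipodal_def pair_set_def doubleton_eq_iff)
  qed
  have "card ?F = (\<Sum>s\<in>{1..n}. card (pair_set ` T s))"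
  proof (rule card_restrictions)
    fix i j A x assume *: "i \<in> {1..n}" "j \<in> {1..n}" "A \<in> pair_set ` T i" "x \<in> A"
      and eq: "reflection n i x = reflection n j x"
    have "1 \<le> x" "x \<le> n" using T[OF *(1)] * by (auto simp: nonantipodal_def pair_set_def)
    then show "i = j" using *(1,2) eq by (auto simp: reflection_def split: if_splits)
  qed (use finT in \<open>auto simp: pair_set_def\<close>)
  then have cardF: "card ?F = (\<Sum>s\<in>{1..n}. card (T s))" by (simp add: card_image inj)
  \<comment> \<open>Agreement at both points gives \<open>2 * x\<close> and \<open>2 * y\<close> the
    same residue \<open>s - k\<close> modulo \<open>n\<close>. As \<open>0 < y - x < n\<close>, this
    forces \<open>2 * (y - x) = n\<close>.\<close>
  have neq: "rotation n k x \<noteq> reflection n s x \<or> rotation n k y \<noteq> reflection n s y"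
    if "k < n" "s \<in> {1..n}" "(x, y) \<in> nonantipodal n" for k s x y
    using that by (auto simp: rotation_def reflection_def nonantipodal_def)
  have disj: "?R \<inter> ?F = {}"
  proof (intro equals0I, elim IntE)
    fix \<alpha> assume R: "\<alpha> \<in> ?R" and F: "\<alpha> \<in> ?F"
    obtain k where k: "k \<in> {0..<n}" "\<And>x. x \<in> dom \<alpha> \<Longrightarrow> the (\<alpha> x) = rotation n k x"
      using R by (rule mem_restrictionsE) blast
    obtain s where s: "s \<in> {1..n}" "dom \<alpha> \<in> pair_set ` T s"
      "\<And>x. x \<in> dom \<alpha> \<Longrightarrow> the (\<alpha> x) = reflection n s x"
      using F by (rule mem_restrictionsE) blast
    then obtain p where p: "p \<in> T s" "dom \<alpha> = pair_set p" by blast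
    have "(fst p, snd p) \<in> nonantipodal n" using T[OF s(1)] p(1) by auto
    moreover have "fst p \<in> dom \<alpha>" "snd p \<in> dom \<alpha>" by (simp_all only: p(2)) (simp_all add: pair_set_def)
    then have "rotation n k (fst p) = reflection n s (fst p)"
      "rotation n k (snd p) = reflection n s (snd p)" using k(2) s(3) by metis+
    ultimately show False using neq k(1) s(1) by (meson atLeastLessThan_iff)
  qed
  have "finite ?R" "finite ?F"
    by (rule finite_restrictions; use finS finT in simp)+
  moreover have "Map.empty \<notin> ?R \<union> ?F"
  proof
    assume "Map.empty \<in> ?R \<union> ?F"
    then show False
    proof
      assume "Map.empty \<in> ?R"
      then show False by (rule mem_restrictionsE) (use S in fastforce)
    next
      assume "Map.empty \<in> ?F"
      then show False by (rule mem_restrictionsE) (auto simp: pair_set_def)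
    qed
  qed
  ultimately show ?thesis using disj cardR cardF by (simp add: card_Un_disjoint)
qed

section \<open>Sums over non-antipodal pairs\<close>

text \<open>Grouping by the difference \<open>d\<close> gives \<open>n - d\<close> pairs each. For
  even \<open>n\<close> the antipodal difference \<open>n div 2\<close>, with its
  \<open>n div 2\<close> pairs, is taken out.\<close>

lemma sum_nonantipodal:
  fixes g :: "nat \<Rightarrow> 'a::comm_ring_1"
  shows "(\<Sum>(x, y)\<in>nonantipodal n. g (y - x)) =
    (\<Sum>d\<in>{1..<n}. of_nat (n - d) * g d) - (if even n then of_nat (n div 2) * g (n div 2) else 0)"
proof (cases "n = 0")
  case True
  then have "nonantipodal n = {}" by (auto simp: nonantipodal_def)
  then show ?thesis using True by simp
next
  case False
  have "(\<Sum>(x, y)\<in>nonantipodal n. g (y - x)) =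
    (\<Sum>(d, x)\<in>Sigma {d\<in>{1..<n}. 2 * d \<noteq> n} (\<lambda>d. {1..n - d}). g d)"
    by (rule sum.reindex_bij_witness[of _ "\<lambda>(d, x). (x, x + d)" "\<lambda>(x, y). (y - x, x)"])
      (auto simp: nonantipodal_def)
  also have "\<dots> = (\<Sum>d\<in>{d\<in>{1..<n}. 2 * d \<noteq> n}. of_nat (n - d) * g d)"
    by (subst sum.Sigma[symmetric]) auto
  also have "\<dots> = (\<Sum>d\<in>{1..<n} - (if even n then {n div 2} else {}). of_nat (n - d) * g d)"
    by (rule sum.cong) (auto split: if_splits)
  also have "\<dots> = (\<Sum>d\<in>{1..<n}. of_nat (n - d) * g d) - (if even n then of_nat (n div 2) * g (n div 2) else 0)"
  proof (cases "even n")
    case True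
    then have "n div 2 \<in> {1..<n}" "n - n div 2 = n div 2" using False by auto
    then show ?thesis using True by (simp add: sum_diff1 del: of_nat_diff)
  qed simp
  finally show ?thesis .
qed

lemma card_nonantipodal:
  "real (card (nonantipodal n)) = real n * (real n - 1) / 2 - (if even n then real n / 2 else 0)"
proof -
  have "(\<Sum>d\<in>{1..<n}. real (n - d)) = real n * (real n - 1) / 2"
  proof (cases n)
    case (Suc m)
    have "(\<Sum>d\<in>{1..<n}. real (n - d)) = (\<Sum>d\<in>{1..<n}. real d)"
      by (rule sum.reindex_bij_witness[of _ "\<lambda>d. n - d" "\<lambda>d. n - d"]) auto
    also have "\<dots> = (\<Sum>d\<in>{1..m}. real d)" by (simp add: Suc atLeastLessThanSuc_atLeastAtMost)
    also have "\<dots> = real n * (real n - 1) / 2" unfolding Suc by (induction m) (auto simp: field_simps)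
    finally show ?thesis .
  qed simp
  then show ?thesis using sum_nonantipodal[of "\<lambda>_. 1 :: real" n]
    by (auto simp: case_prod_unfold elim!: evenE)
qed

lemma sum_diff_nonantipodal:
  "(\<Sum>(x, y)\<in>nonantipodal n. real (y - x)) =
    (real n + 1) * real n * (real n - 1) / 6 - (if even n then (real n)\<^sup>2 / 4 else 0)"
proof -
  have sq: "(\<Sum>d\<in>{1..<n}. real d) = real n * (real n - 1) / 2"
    "(\<Sum>d\<in>{1..<n}. (real d)\<^sup>2) = real n * (real n - 1) * (2 * real n - 1) / 6"
    by (induction n) (auto simp: field_simps power2_eq_square)
  have "(\<Sum>d\<in>{1..<n}. real (n - d) * real d) = (\<Sum>d\<in>{1..<n}. real n * real d - (real d)\<^sup>2)"
    by (rule sum.cong) (auto simp: algebra_simps power2_eq_square)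
  also have "\<dots> = real n * (\<Sum>d\<in>{1..<n}. real d) - (\<Sum>d\<in>{1..<n}. (real d)\<^sup>2)"
    by (simp add: sum_subtractf sum_distrib_left)
  also have "\<dots> = (real n + 1) * real n * (real n - 1) / 6"
    unfolding sq by (simp add: field_simps power2_eq_square)
  finally show ?thesis using sum_nonantipodal[of "real" n]
    by (auto simp: power2_eq_square elim!: evenE)
qed

lemma card_nonempty_subsets: "finite A \<Longrightarrow> real (card (Pow A - {{}})) = 2 ^ card A - 1"
  by (subst card_Diff_singleton) (auto simp: card_Pow of_nat_diff)

section \<open>Evaluation of the two cardinalities\<close>

theorem theorem2p1:
  fixes n :: nat
  assumes "n \<ge> 3"
  shows "real (card (ODI n)) =
           3 * 2 ^ n + (real n + 1) * real n * (real n - 1) / 6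
           - (1 + (- 1) ^ n) / 8 * (real n)\<^sup>2 - 2 * real n - 2
       \<and> real (card (OPDI n)) =
           real n * 2 ^ n + (real n)\<^sup>2 * (real n - 1) / 2
           - (1 + (- 1) ^ n) / 4 * (real n)\<^sup>2 - real n + 1"
proof
  let ?S = "\<lambda>k. (Pow {1..n - k} - {{}}) \<union> (Pow {n - k + 1..n} - {{}})"
  let ?T = "\<lambda>s. {(x, y). (x, y) \<in> nonantipodal n \<and> x < s \<and> s \<le> y}"
  have sign: "(1 + (- 1) ^ n :: real) = (if even n then 2 else 0)" by simp
  \<comment> \<open>The blocks of sizes \<open>n - k\<close> and \<open>k\<close> are disjoint, so
    they share no nonempty subset.\<close>
  have S: "real (card (?S k)) = 2 ^ (n - k) + 2 ^ k - 2" if "k < n" for k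
  proof -
    have "card (?S k) = card (Pow {1..n - k} - {{}}) + card (Pow {n - k + 1..n} - {{}})"
      by (rule card_Un_disjoint) force+
    then have "real (card (?S k)) =
        real (card (Pow {1..n - k} - {{}})) + real (card (Pow {n - k + 1..n} - {{}}))" by simp
    also have "\<dots> = (2 ^ (n - k) - 1) + (2 ^ k - 1)"
      using that card_nonempty_subsets[of "{1..n - k}"] card_nonempty_subsets[of "{n - k + 1..n}"]
      by simp
    finally show ?thesis by simp
  qed
  have "(\<Sum>k\<in>{0..<n}. (2::real) ^ k) = 2 ^ n - 1"
    by (induction n) auto
  moreover have "(\<Sum>k\<in>{0..<n}. (2::real) ^ (n - k)) = 2 * 2 ^ n - 2"
  proof -
    have "(\<Sum>k\<in>{0..<n}. (2::real) ^ (n - k)) = (\<Sum>k\<in>{0..<n}. 2 * 2 ^ k)"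
      by (rule sum.reindex_bij_witness[of _ "\<lambda>k. n - 1 - k" "\<lambda>k. n - 1 - k"])
        (auto simp flip: power_Suc)
    also have "\<dots> = 2 * 2 ^ n - 2" by (induction n) auto
    finally show ?thesis .
  qed
  moreover have "real (\<Sum>k\<in>{0..<n}. card (?S k)) = (\<Sum>k\<in>{0..<n}. 2 ^ (n - k) + 2 ^ k - 2)"
    unfolding of_nat_sum by (rule sum.cong) (use S in auto)
  ultimately have sumS: "real (\<Sum>k\<in>{0..<n}. card (?S k)) = 3 * 2 ^ n - 3 - 2 * real n"
    by (simp add: sum.distrib sum_subtractf)
  \<comment> \<open>Double counting: instead of the pairs for each reflection, the
    \<open>y - x\<close> reflections for each pair are summed.\<close>
  have "(\<Sum>s\<in>{1..n}. card (?T s)) = (\<Sum>s\<in>{1..n}. \<Sum>p\<in>{p\<in>nonantipodal n. fst p < s \<and> s \<le> snd p}. 1)"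
    by (auto intro!: sum.cong arg_cong[of _ _ card])
  also have "\<dots> = (\<Sum>p\<in>nonantipodal n. \<Sum>s\<in>{s\<in>{1..n}. fst p < s \<and> s \<le> snd p}. 1)"
    by (rule sum.swap_restrict) (use finite_nonantipodal in auto)
  also have "\<dots> = (\<Sum>p\<in>nonantipodal n. snd p - fst p)"
  proof (rule sum.cong)
    fix p assume "p \<in> nonantipodal n"
    then have "{s\<in>{1..n}. fst p < s \<and> s \<le> snd p} = {fst p<..snd p}"
      by (auto simp: nonantipodal_def)
    then show "(\<Sum>s\<in>{s\<in>{1..n}. fst p < s \<and> s \<le> snd p}. 1) = snd p - fst p" by simp
  qed simp
  finally have sumT: "real (\<Sum>s\<in>{1..n}. card (?T s)) = (\<Sum>(x, y)\<in>nonantipodal n. real (y - x))"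
    by (simp add: case_prod_unfold)
  \<comment> \<open>The summand \<open>1\<close> is the empty map.\<close>
  have "card (ODI n) = 1 + (\<Sum>k\<in>{0..<n}. card (?S k)) + (\<Sum>s\<in>{1..n}. card (?T s))"
    unfolding ODI_eq by (rule card_rotation_reflection_union) (auto simp: Omega_def)
  then have "real (card (ODI n)) = 1 + (3 * 2 ^ n - 3 - 2 * real n) +
      ((real n + 1) * real n * (real n - 1) / 6 - (if even n then (real n)\<^sup>2 / 4 else 0))"
    by (simp only: of_nat_add of_nat_1 sumS sumT sum_diff_nonantipodal)
  then show "real (card (ODI n)) =
           3 * 2 ^ n + (real n + 1) * real n * (real n - 1) / 6
           - (1 + (- 1) ^ n) / 8 * (real n)\<^sup>2 - 2 * real n - 2"
    unfolding sign by simp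
  have "card (OPDI n) = 1 + (\<Sum>k\<in>{0..<n}. card (Pow (Omega n) - {{}})) + (\<Sum>s\<in>{1..n}. card (nonantipodal n))"
    unfolding OPDI_eq by (rule card_rotation_reflection_union) auto
  then have "real (card (OPDI n)) = 1 + real n * (2 ^ n - 1) + real n * real (card (nonantipodal n))"
    using card_nonempty_subsets[of "Omega n"] by (simp add: Omega_def)
  then show "real (card (OPDI n)) =
           real n * 2 ^ n + (real n)\<^sup>2 * (real n - 1) / 2
           - (1 + (- 1) ^ n) / 4 * (real n)\<^sup>2 - real n + 1"
    unfolding sign card_nonantipodal by (cases "even n") (simp_all add: field_simps power2_eq_square)
qed

end
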